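(* Let $d\geqslant 1$ and $k\in\mathbb N_0$ be integers, let $\Omega\subset\mathbb R^d$ be a bounded open polyhedral set, $\mathcal T$ a conforming simplicial mesh of $\Omega$, and $\mathbb E$ a finite-dimensional real vector space with $m=\dim\mathbb E\geqslant1$, identified with $\mathbb R^m$ through a fixed basis. Let $M=\binom{d+k}{k}$, and suppose that $\mathcal T$ admits a half-open decomposition. Then $\mathrm{NN}_d^m(k;2H_{\mathcal T},MN_{\mathcal T})$ realizes $\mathcal V_k(\mathcal T;\mathbb E)$ pointwise on $\overline\Omega$: every $\boldsymbol v\in\mathcal V_k(\mathcal T;\mathbb E)$ agrees at every point of $\overline\Omega$ with some member of $\mathrm{NN}_d^m(k;2H_{\mathcal T},MN_{\mathcal T})$. For fixed $d$ and $k$, the hidden parameters $\boldsymbol W_{\mathrm I},\boldsymbol b_{\mathrm I},\boldsymbol W_{\mathrm{II},0},\boldsymbol W_{\mathrm{II},1},\boldsymbol b_{\mathrm{II}}$ depend only on the mesh and the chosen half-open decomposition. All components share these parameters, and only the output coefficients $\boldsymbol W_{\mathrm{III}}$ vary with the represented function.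
   Context: Mesh. $\Omega\subset\mathbb R^d$ is a bounded open polyhedral set, not necessarily convex or connected. A conforming simplicial mesh $\mathcal T=\{\tau_1,\dots,\tau_{N_{\mathcal T}}\}$ of $\Omega$ is a finite collection of pairwise disjoint open $d$-simplices $\tau_i\subset\Omega$ (elements) with $\bigcup_{\tau\in\mathcal T}\overline\tau=\overline\Omega$ such that for $i\neq j$ the set $\overline\tau_i\cap\overline\tau_j$ is either empty or a common subsimplex (face) of both. $N_{\mathcal T}$ is the number of elements. $H_{\mathcal T}$ is the number of distinct unoriented affine hyperplanes supporting the $(d-1)$-dimensional facets of elements (coplanar facets contribute only once). For an element $\tau$ with vertices $\boldsymbol x_0,\dots,\boldsymbol x_d$, $\lambda_0^\tau,\dots,\lambda_d^\tau:\mathbb R^d\to\mathbb R$ are its barycentric coordinate functions (affine, $\lambda_i^\tau(\boldsymbol x_j)=\delta_{ij}$, $\sum_i\lambda_i^\tau\equiv1$). Half-open decomposition. For each $\tau\in\mathcal T$ choose complementary index sets $\mathcal I_\tau^+\sqcup\mathcal I_\tau^-=\{0,\dots,d\}$ (either may be empty) and set $$\widetilde\tau=\{\boldsymbol x\in\mathbb R^d:\lambda_i^\tau(\boldsymbol x)\geqslant0\text{ for }i\in\mathcal I_\tau^+;\ \lambda_i^\tau(\boldsymbol x)>0\text{ for }i\in\mathcal I_\tau^-\}.$$ The family $\{\widetilde\tau:\tau\in\mathcal T\}$ is a half-open decomposition of $\mathcal T$ if $\overline\Omega=\bigsqcup_{\tau\in\mathcal T}\widetilde\tau$ (disjoint union).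 Function space. $\mathcal V_k(\mathcal T;\mathbb E)$ is the space of $\boldsymbol v\in C(\overline\Omega;\mathbb E)$ such that for every $\tau\in\mathcal T$, $\boldsymbol v|_\tau$ is an $\mathbb E$-valued polynomial of total degree at most $k$. Networks. $\varrho_0(t)=\mathbf 1_{\{t>0\}}$ and $\varrho_j(t)=(\max\{t,0\})^j$ for $j\geqslant1$, applied componentwise to vectors. For positive integers $d,m,n_1,n_2$ and $k\in\mathbb N_0$, $\mathrm{NN}_d^m(k;n_1,n_2)$ is the class of functions $\mathbb R^d\to\mathbb R^m$ of the form $$\boldsymbol x\mapsto\boldsymbol W_{\mathrm{III}}\,\varrho_k\big(\boldsymbol W_{\mathrm{II},0}\varrho_0(\boldsymbol W_{\mathrm I}\boldsymbol x+\boldsymbol b_{\mathrm I})+\boldsymbol W_{\mathrm{II},1}\varrho_1(\boldsymbol W_{\mathrm I}\boldsymbol x+\boldsymbol b_{\mathrm I})+\boldsymbol b_{\mathrm{II}}\big)$$ with $\boldsymbol W_{\mathrm I}\in\mathbb R^{n_1\times d}$, $\boldsymbol b_{\mathrm I}\in\mathbb R^{n_1}$, $\boldsymbol W_{\mathrm{II},0},\boldsymbol W_{\mathrm{II},1}\in\mathbb R^{n_2\times n_1}$, $\boldsymbol b_{\mathrm{II}}\in\mathbb R^{n_2}$, $\boldsymbol W_{\mathrm{III}}\in\mathbb R^{m\times n_2}$. All parameters other than $\boldsymbol W_{\mathrm{III}}$ are called hidden parameters; the entries of $\boldsymbol W_{\mathrm{III}}$ are the output coefficients. The dependence statement means the hidden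 parameters can be chosen once, before $\boldsymbol v$, with only $\boldsymbol W_{\mathrm{III}}$ depending on $\boldsymbol v$. *)

theory Defs
  imports "HOL-Analysis.Analysis"
begin

section \<open>Meshes\<close>

text \<open>
  The closure condition is the weakest of the usual readings of ``polyhedral'': it holds whenever
  the set is a finite Boolean combination of half-spaces, or its boundary is a finite union of
  polytopes. For a bounded set the convex polyhedra below are polytopes.
\<close>

definition polyhedral_set :: "'a::euclidean_space set \<Rightarrow> bool" where
  "polyhedral_set S \<longleftrightarrow> (\<exists>F. finite F \<and> (\<forall>P\<in>F. polyhedron P) \<and> closure S = \<Union>F)"

definition open_simplex :: "'a::euclidean_space set \<Rightarrow> bool" where
  "open_simplex \<tau> \<longleftrightarrow> (\<exists>S. int DIM('a) simplex S \<and> \<tau> = interior S)"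

text \<open>
  The relation \<^const>\<open>face_of\<close> holds for the empty set, so it covers the case of disjoint closures.
\<close>

definition conforming_simplicial_mesh :: "'a::euclidean_space set \<Rightarrow> 'a set set \<Rightarrow> bool" where
  "conforming_simplicial_mesh \<Omega> \<T> \<longleftrightarrow>
     finite \<T> \<and>
     (\<forall>\<tau>\<in>\<T>. open_simplex \<tau> \<and> \<tau> \<subseteq> \<Omega>) \<and>
     pairwise disjnt \<T> \<and>
     (\<Union>\<tau>\<in>\<T>. closure \<tau>) = closure \<Omega> \<and>
     (\<forall>\<sigma>\<in>\<T>. \<forall>\<tau>\<in>\<T>. \<sigma> \<noteq> \<tau> \<longrightarrow>
        closure \<sigma> \<inter> closure \<tau> face_of closure \<sigma> \<and> closure \<sigma> \<inter> closure \<tau> face_of closure \<tau>)"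

definition facet_hyperplanes :: "'a::euclidean_space set set \<Rightarrow> 'a set set" where
  "facet_hyperplanes \<T> = {affine hull F | F \<tau>. \<tau> \<in> \<T> \<and> F facet_of closure \<tau>}"

section \<open>Barycentric coordinates and half-open decompositions\<close>

definition vertices :: "'a::euclidean_space set \<Rightarrow> 'a set" where
  "vertices \<tau> = {v. v extreme_point_of closure \<tau>}"

definition affine_function :: "('a::real_vector \<Rightarrow> real) \<Rightarrow> bool" where
  "affine_function f \<longleftrightarrow> linear (\<lambda>x. f x - f 0)"

text \<open>
  Barycentric coordinates are indexed by the vertices themselves rather than by numbers.
  Lemma \<open>bary_ex1\<close> below justifies the definite description.
\<close>

definition bary :: "'a::euclidean_space set \<Rightarrow> 'a \<Rightarrow> 'a \<Rightarrow> real" where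
  "bary \<tau> v = (THE f. affine_function f \<and> (\<forall>w\<in>vertices \<tau>. f w = (if w = v then 1 else 0)))"

lemma vertices_open_simplex:
  fixes \<tau> :: "'a::euclidean_space set"
  assumes "open_simplex \<tau>"
  obtains C where "\<not> affine_dependent C" "finite C" "card C = DIM('a) + 1"
    "\<tau> = interior (convex hull C)" "closure \<tau> = convex hull C" "vertices \<tau> = C"
    "affine hull C = UNIV"
proof -
  obtain C where C: "\<not> affine_dependent C" "int (card C) = int DIM('a) + 1"
    "\<tau> = interior (convex hull C)"
    using assms unfolding open_simplex_def simplex_def by auto
  have fin: "finite C" using C(1) by (rule aff_independent_finite)
  have crd: "card C = DIM('a) + 1" using C(2) by linarith
  have "C \<noteq> {}" using crd by auto
  have hull: "affine hull C = UNIV"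
    using affine_independent_span_eq[OF C(1)] crd by simp
  have ne: "interior (convex hull C) \<noteq> {}"
    using interior_convex_hull_eq_empty[of C] C(1) crd by simp
  have "closure \<tau> = closure (convex hull C)"
    using C(3) ne by (simp add: convex_closure_interior)
  also have "\<dots> = convex hull C"
    using fin by (simp add: compact_imp_closed finite_imp_compact_convex_hull)
  finally have cl: "closure \<tau> = convex hull C" .
  have "vertices \<tau> = C"
    unfolding vertices_def cl extreme_point_of_convex_hull_affine_independent[OF C(1)] by simp
  then show ?thesis using that C fin crd cl hull by blast
qed

lemma affine_function_eq_on_hull:
  assumes f: "affine_function f" and g: "affine_function g" and fin: "finite C"
    and eq: "\<And>w. w \<in> C \<Longrightarrow> f w = g w" and x: "x \<in> affine hull C"
  shows "f x = g x"
proof -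
  obtain u where u: "sum u C = 1" "x = (\<Sum>w\<in>C. u w *\<^sub>R w)"
    using x by (auto simp: affine_hull_finite[OF fin])
  have comb: "h x = (\<Sum>w\<in>C. u w * h w)" if "affine_function h" for h
  proof -
    have lin: "linear (\<lambda>x. h x - h 0)" using that by (simp add: affine_function_def)
    have "h x - h 0 = (\<Sum>w\<in>C. u w * (h w - h 0))"
      using linear_sum[OF lin, of "\<lambda>w. u w *\<^sub>R w" C] linear_scale[OF lin] u(2) by simp
    also have "\<dots> = (\<Sum>w\<in>C. u w * h w) - h 0"
      by (simp add: right_diff_distrib sum_subtractf flip: sum_distrib_right) (simp add: u(1))
    finally show ?thesis by simp
  qed
  show ?thesis using comb[OF f] comb[OF g] eq by simp
qed

lemma bary_ex1:
  assumes "open_simplex \<tau>" "v \<in> vertices \<tau>"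
  shows "\<exists>!f. affine_function f \<and> (\<forall>w\<in>vertices \<tau>. f w = (if w = v then 1 else 0))"
proof -
  obtain C where C: "\<not> affine_dependent C" "finite C" "vertices \<tau> = C" "affine hull C = UNIV"
    using vertices_open_simplex[OF assms(1)] by metis
  have vC: "v \<in> C" using assms(2) C(3) by simp
  define B where "B = (\<lambda>x. - v + x) ` (C - {v})"
  have "independent B"
    using C(1) vC affine_dependent_iff_dependent2[OF vC] unfolding B_def by simp
  then obtain g :: "_ \<Rightarrow> real" where g: "linear g" "\<And>x. x \<in> B \<Longrightarrow> g x = - 1"
    using linear_independent_extend[of B "\<lambda>_. - 1 :: real"] by auto
  define f where "f x = 1 + g (x - v)" for x
  have "affine_function f"
    unfolding affine_function_def f_def using g(1)
    by (simp add: linear_diff[OF g(1)] linear_0[OF g(1)] linear_neg[OF g(1)])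
  moreover have "f w = (if w = v then 1 else 0)" if "w \<in> C" for w
  proof (cases "w = v")
    case False
    then have "w - v \<in> B" using that by (auto simp: B_def image_iff intro!: bexI[of _ w])
    then show ?thesis using False g(2) by (simp add: f_def)
  qed (simp add: f_def linear_0[OF g(1)])
  moreover have "f1 = f2"
    if "affine_function f1" "affine_function f2" "\<forall>w\<in>C. f1 w = (if w = v then 1 else 0)"
       "\<forall>w\<in>C. f2 w = (if w = v then 1 else 0)" for f1 f2
    using affine_function_eq_on_hull[OF that(1,2) C(2)] that(3,4) C(4) by (intro ext) auto
  ultimately show ?thesis unfolding C(3) by blast
qed

text \<open>
  The set \<open>I\<close> is the set of vertices whose barycentric coordinate enters with a weak inequality;
  its complement in the vertex set carries the strict inequalities.
\<close>

definition half_open_cell :: "'a::euclidean_space set \<Rightarrow> 'a set \<Rightarrow> 'a set" where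
  "half_open_cell \<tau> I =
     {x. (\<forall>v\<in>I. bary \<tau> v x \<ge> 0) \<and> (\<forall>v\<in>vertices \<tau> - I. bary \<tau> v x > 0)}"

definition half_open_decomposition ::
    "'a::euclidean_space set \<Rightarrow> 'a set set \<Rightarrow> ('a set \<Rightarrow> 'a set) \<Rightarrow> bool" where
  "half_open_decomposition \<Omega> \<T> I \<longleftrightarrow>
     (\<forall>\<tau>\<in>\<T>. I \<tau> \<subseteq> vertices \<tau>) \<and>
     disjoint_family_on (\<lambda>\<tau>. half_open_cell \<tau> (I \<tau>)) \<T> \<and>
     closure \<Omega> = (\<Union>\<tau>\<in>\<T>. half_open_cell \<tau> (I \<tau>))"

section \<open>Piecewise polynomial functions\<close>

definition ordered_basis :: "nat \<Rightarrow> (nat \<Rightarrow> 'e::real_vector) \<Rightarrow> 'e set \<Rightarrow> bool" where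
  "ordered_basis m e E \<longleftrightarrow>
     inj_on e {..<m} \<and> independent (e ` {..<m}) \<and> span (e ` {..<m}) = E"

definition polynomials ::
    "nat \<Rightarrow> 'e::real_vector set \<Rightarrow> (real ^ 'n \<Rightarrow> 'e) set" where
  "polynomials k E =
     {p. \<exists>c :: ('n \<Rightarrow> nat) \<Rightarrow> 'e. range c \<subseteq> E \<and>
         (\<forall>x. p x = (\<Sum>\<alpha> | sum \<alpha> UNIV \<le> k. (\<Prod>i\<in>UNIV. (x $ i) ^ \<alpha> i) *\<^sub>R c \<alpha>))}"

text \<open>
  Functions on \<open>closure \<Omega>\<close> are total functions whose values outside \<open>closure \<Omega>\<close> are irrelevant.
\<close>

definition pw_poly_space ::
    "nat \<Rightarrow> (real ^ 'n) set \<Rightarrow> (real ^ 'n) set set \<Rightarrow> 'e::real_normed_vector set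
      \<Rightarrow> (real ^ 'n \<Rightarrow> 'e) set" where
  "pw_poly_space k \<Omega> \<T> E =
     {v. continuous_on (closure \<Omega>) v \<and> v ` closure \<Omega> \<subseteq> E \<and>
         (\<forall>\<tau>\<in>\<T>. \<exists>p\<in>polynomials k E. \<forall>x\<in>\<tau>. v x = p x)}"

section \<open>Networks\<close>

definition rho :: "nat \<Rightarrow> real \<Rightarrow> real" where
  "rho j t = (if j = 0 then (if t > 0 then 1 else 0) else (max t 0) ^ j)"

text \<open>
  As the widths vary, matrices and vectors are functions on natural numbers of which only the
  entries below the respective width are used; the rows of the first weight matrix are elements
  of the input space. A vector in \<open>\<real>\<^sup>m\<close> is a function \<open>nat \<Rightarrow> real\<close> vanishing from \<open>m\<close> on.
\<close>

definition network ::
    "nat \<Rightarrow> nat \<Rightarrow> nat \<Rightarrow> nat \<Rightarrow> (nat \<Rightarrow> real ^ 'n) \<Rightarrow> (nat \<Rightarrow> real)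
      \<Rightarrow> (nat \<Rightarrow> nat \<Rightarrow> real) \<Rightarrow> (nat \<Rightarrow> nat \<Rightarrow> real) \<Rightarrow> (nat \<Rightarrow> real)
      \<Rightarrow> (nat \<Rightarrow> nat \<Rightarrow> real) \<Rightarrow> real ^ 'n \<Rightarrow> nat \<Rightarrow> real" where
  "network m k n1 n2 W1 b1 W20 W21 b2 W3 x j =
     (if j < m then
        \<Sum>l<n2. W3 j l *
          rho k ((\<Sum>i<n1. W20 l i * rho 0 (W1 i \<bullet> x + b1 i)) +
                 (\<Sum>i<n1. W21 l i * rho 1 (W1 i \<bullet> x + b1 i)) + b2 l)
      else 0)"

definition NN :: "nat \<Rightarrow> nat \<Rightarrow> nat \<Rightarrow> nat \<Rightarrow> (real ^ 'n \<Rightarrow> nat \<Rightarrow> real) set" where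
  "NN m k n1 n2 = {network m k n1 n2 W1 b1 W20 W21 b2 W3 | W1 b1 W20 W21 b2 W3. True}"

end

theory Submission
  imports Defs "HOL-Combinatorics.Stirling" "HOL-Library.Multiset"
begin

text \<open>
  The construction spends one second-layer neuron on each pair of an element \<open>\<tau>\<close> and a multi-index
  \<open>\<alpha>\<close> of degree at most \<open>k\<close>. On the half-open cell of \<open>\<tau>\<close> this neuron receives the positive value
  \<open>B + \<alpha> \<bullet> x\<close>; on the other cells its input is at most \<open>0\<close>. Its output is therefore the power \<open>(B + \<alpha> \<bullet> x) ^ k\<close> restricted to the cell. This includes \<open>k = 0\<close>, since the step
  activation is \<open>1\<close> at positive and \<open>0\<close> at nonpositive arguments. As the cells partition the closure
  of \<open>\<Omega>\<close>, exactly one element contributes at each point, and the output layer may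
  realize the polynomial pieces independently of each other.

  Two facts make this work. The first is algebraic: the powers \<open>(B + \<alpha> \<bullet> x) ^ k\<close> span all polynomials
  of degree at most \<open>k\<close> (\<open>monomial_in_span_of_powers\<close>). Finite differences in \<open>\<alpha>\<close> extract the monomials one
  after the other, in the order of decreasing degree. The number of multi-indices is the binomial
  coefficient in the statement (\<open>card_multi_indices\<close>).

  The second is geometric: the required input is available from two first-layer neurons per
  facet hyperplane (\<open>half_open_gate\<close>). Each barycentric coordinate of \<open>\<tau>\<close> is a multiple of the
  form that defines a facet hyperplane, so the step and ramp activations of the form and of its
  negative give the coordinate itself and the indicators of its being positive and of its being
  negative. Every affine function is a linear combination of the barycentric coordinates of \<open>\<tau>\<close>;
  subtracting a large multiple of the number of violated cell inequalities makes it nonpositive off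
  the cell. The indicators being strict and two-sided, this respects which boundary points belong to
  the cell.

  None of these choices involves the function to be represented, which enters through the coefficients
  of its pieces with respect to the powers only.
\<close>

section \<open>Multi-indices\<close>

definition multi_indices :: "nat \<Rightarrow> ('n::finite \<Rightarrow> nat) set" where
  "multi_indices k = {\<alpha>. sum \<alpha> UNIV \<le> k}"

text \<open>
  Homogenisation: the slack \<open>k - sum \<alpha> UNIV\<close> becomes the multiplicity of the extra letter
  \<^const>\<open>None\<close>. This reduces counting multi-indices to counting multisets of size \<open>k\<close> over
  \<open>n + 1\<close> letters.
\<close>

lemma bij_betw_multi_indices:
  "bij_betw (\<lambda>X i. count X (Some i)) (multisets_of_size (UNIV :: 'n::finite option set) k)
     (multi_indices k :: ('n \<Rightarrow> nat) set)"
proof -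
  have size_eq: "size X = count X None + (\<Sum>i\<in>UNIV. count X (Some i))" for X :: "'n option multiset"
  proof -
    have "size X = (\<Sum>y\<in>UNIV. count X y)"
      unfolding size_multiset_overloaded_eq
      by (rule sum.mono_neutral_left) (auto simp: count_eq_zero_iff)
    then show ?thesis
      by (simp add: UNIV_option_conv sum.reindex)
  qed
  show ?thesis
  proof (rule bij_betw_imageI)
    show "inj_on (\<lambda>X i. count X (Some i)) (multisets_of_size (UNIV :: 'n option set) k)"
    proof (rule inj_onI, rule multiset_eqI)
      fix X Y :: "'n option multiset" and y
      assume "X \<in> multisets_of_size UNIV k" "Y \<in> multisets_of_size UNIV k"
        and eq: "(\<lambda>i. count X (Some i)) = (\<lambda>i. count Y (Some i))"
      then have "size X = size Y" by (simp add: multisets_of_size_def)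
      then show "count X y = count Y y"
        using fun_cong[OF eq] size_eq[of X] size_eq[of Y] by (cases y) auto
    qed
    show "(\<lambda>X i. count X (Some i)) ` multisets_of_size (UNIV :: 'n option set) k = multi_indices k"
    proof (intro equalityI subsetI)
      fix \<alpha> :: "'n \<Rightarrow> nat" assume \<alpha>: "\<alpha> \<in> multi_indices k"
      define X where "X = Abs_multiset (case_option (k - sum \<alpha> UNIV) \<alpha>)"
      have cnt: "count X = case_option (k - sum \<alpha> UNIV) \<alpha>"
        unfolding X_def by (rule count_Abs_multiset) simp
      have "size X = k" using \<alpha> by (simp add: size_eq cnt multi_indices_def)
      then show "\<alpha> \<in> (\<lambda>X i. count X (Some i)) ` multisets_of_size UNIV k"
        by (intro image_eqI[of _ _ X]) (auto simp: cnt multisets_of_size_def)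
    qed (auto simp: multisets_of_size_def multi_indices_def size_eq)
  qed
qed

lemma finite_multi_indices: "finite (multi_indices k :: ('n::finite \<Rightarrow> nat) set)"
  using bij_betw_finite[OF bij_betw_multi_indices] finite_multisets_of_size[OF finite] by blast

lemma card_multi_indices:
  "card (multi_indices k :: ('n::finite \<Rightarrow> nat) set) = (CARD('n) + k) choose k"
  using bij_betw_same_card[OF bij_betw_multi_indices[where 'n = 'n and k = k]]
  by (simp add: card_multisets_of_size)

section \<open>Powers of affine functions span the polynomials\<close>

text \<open>
  The left-hand side is the \<open>b\<close>-th forward difference at \<open>0\<close> of \<open>a \<mapsto> a ^ n\<close>. Multiplying the
  summand by \<open>a\<close> and absorbing it into the binomial coefficient gives the recurrence of the
  Stirling numbers of the second kind. What matters later is that the value vanishes for \<open>n < b\<close>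
  and is nonzero for \<open>n = b\<close>.
\<close>

lemma alternating_binomial_power_sum:
  "(\<Sum>a\<le>b. (- 1) ^ (b + a) * real (b choose a) * real a ^ n) = fact b * real (Stirling n b)"
proof (induction n arbitrary: b)
  case 0
  show ?case
  proof (cases b)
    case (Suc b')
    have "(\<Sum>a\<le>b. (- 1) ^ (b + a) * real (b choose a) * real a ^ 0) =
        (- 1) ^ b * (\<Sum>a\<le>b. (- 1) ^ a * real (b choose a))"
      by (simp only: sum_distrib_left power_add mult.assoc power_0 mult_1_right)
    also have "\<dots> = 0"
      using choose_alternating_sum[of b, where 'a = real] Suc by (simp only: zero_less_Suc mult_zero_right)
    finally show ?thesis using Suc by simp
  qed simp
next
  case (Suc n)
  show ?case
  proof (cases b)
    case (Suc b')
    let ?D = "\<lambda>b n. \<Sum>a\<le>b. (- 1) ^ (b + a) * real (b choose a) * real a ^ n"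
    \<comment> \<open>Absorption of the factor \<open>a\<close> combined with Pascal's rule.\<close>
    have absorb: "real (Suc b' choose a) * real a = real (Suc b') * (real (Suc b' choose a) - real (b' choose a))" for a
    proof (cases a)
      case (Suc a')
      have "real (Suc a') * real (Suc b' choose Suc a') = real (Suc b') * real (b' choose a')"
        by (metis Suc_times_binomial of_nat_mult)
      then show ?thesis using Suc by (simp add: algebra_simps)
    qed simp
    have "?D (Suc b') (Suc n) =
        (\<Sum>a\<le>Suc b'. (- 1) ^ (Suc b' + a) * (real (Suc b' choose a) * real a) * real a ^ n)"
      by (intro sum.cong) (simp_all only: power_Suc mult_ac)
    also have "\<dots> = real (Suc b') * (?D (Suc b') n +
        (\<Sum>a\<le>Suc b'. (- 1) ^ (b' + a) * real (b' choose a) * real a ^ n))"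
      unfolding absorb sum_distrib_left distrib_left sum.distrib[symmetric]
      by (intro sum.cong) (simp_all add: algebra_simps)
    also have "\<dots> = real (Suc b') * (?D (Suc b') n + ?D b' n)"
      by simp
    also have "\<dots> = fact b * real (Stirling (Suc n) b)"
      unfolding Suc.IH Suc by (simp add: algebra_simps)
    finally show ?thesis using Suc by simp
  qed simp
qed

text \<open>
  The multinomial theorem with implicit coefficients. Their positivity says that no monomial of
  degree at most \<open>k\<close> is missing from the expansion, which is what allows recovering monomials from
  powers.
\<close>

lemma power_of_sum_expansion:
  fixes B :: real
  assumes "B > 0"
  shows "\<exists>c. (\<forall>\<beta>\<in>multi_indices k. c \<beta> > 0) \<and>
    (\<forall>y :: 'n::finite \<Rightarrow> real. (B + sum y UNIV) ^ k = (\<Sum>\<beta>\<in>multi_indices k. c \<beta> * (\<Prod>i\<in>UNIV. y i ^ \<beta> i)))"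
proof (induction k)
  case 0
  have "multi_indices 0 = {\<lambda>_ :: 'n. 0}" by (auto simp: multi_indices_def fun_eq_iff)
  then show ?case by (intro exI[of _ "\<lambda>_. 1"]) simp
next
  case (Suc k)
  let ?A = "multi_indices :: nat \<Rightarrow> ('n \<Rightarrow> nat) set"
  let ?m = "\<lambda>(y :: 'n \<Rightarrow> real) \<beta>. \<Prod>i\<in>UNIV. y i ^ \<beta> i"
  obtain c where c_pos: "\<And>\<beta>. \<beta> \<in> ?A k \<Longrightarrow> c \<beta> > 0"
    and c: "\<And>y. (B + sum y UNIV) ^ k = (\<Sum>\<beta>\<in>?A k. c \<beta> * ?m y \<beta>)"
    using Suc.IH by blast
  have sub: "?A k \<subseteq> ?A (Suc k)" by (auto simp: multi_indices_def)
  define down where "down i \<beta> = \<beta>(i := \<beta> i - 1)" for i and \<beta> :: "'n \<Rightarrow> nat"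
  have sum_upd: "sum (\<beta>(i := n)) UNIV + \<beta> i = sum \<beta> UNIV + n" for \<beta> :: "'n \<Rightarrow> nat" and i n
    by (simp add: sum.remove[of UNIV i] )
  have down_A: "down i \<beta> \<in> ?A k" if "\<beta> \<in> ?A (Suc k)" "\<beta> i > 0" for i \<beta>
    using that sum_upd[of \<beta> i "\<beta> i - 1"] by (auto simp: multi_indices_def down_def)
  \<comment> \<open>A monomial of the next power arises from the factor \<open>B\<close> or by raising one of its exponents.\<close>
  define c' where "c' \<beta> = (if \<beta> \<in> ?A k then B * c \<beta> else 0) +
      (\<Sum>i\<in>UNIV. if \<beta> i > 0 then c (down i \<beta>) else 0)" for \<beta>
  have "c' \<beta> > 0" if \<beta>: "\<beta> \<in> ?A (Suc k)" for \<beta>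
  proof -
    have nonneg: "(if \<beta> i > 0 then c (down i \<beta>) else 0) \<ge> 0" for i
      using c_pos[OF down_A[OF \<beta>]] by (simp add: less_imp_le)
    show ?thesis
    proof (cases "\<beta> \<in> ?A k")
      case True
      then show ?thesis unfolding c'_def using c_pos assms
        by (intro add_pos_nonneg sum_nonneg nonneg) simp
    next
      case False
      then have "sum \<beta> UNIV > 0" by (simp add: multi_indices_def)
      then obtain i where i: "\<beta> i > 0" by (metis gr0I less_irrefl sum.neutral)
      have "0 < c (down i \<beta>)" using c_pos down_A[OF \<beta> i] by blast
      then have "0 < (\<Sum>i\<in>UNIV. if \<beta> i > 0 then c (down i \<beta>) else 0)"
        using i nonneg by (intro sum_pos2[of _ i]) auto
      then show ?thesis using False by (simp add: c'_def)
    qed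
  qed
  moreover have "(B + sum y UNIV) ^ Suc k = (\<Sum>\<beta>\<in>?A (Suc k). c' \<beta> * ?m y \<beta>)" for y
  proof -
    have shift: "y i * (\<Sum>\<beta>\<in>?A k. c \<beta> * ?m y \<beta>) =
        (\<Sum>\<beta>\<in>?A (Suc k). (if \<beta> i > 0 then c (down i \<beta>) else 0) * ?m y \<beta>)" for i
    proof -
      have "y i * (\<Sum>\<beta>\<in>?A k. c \<beta> * ?m y \<beta>) = (\<Sum>\<beta>\<in>?A k. c \<beta> * (y i * ?m y \<beta>))"
        by (simp add: sum_distrib_left mult_ac)
      also have "\<dots> = (\<Sum>\<beta>\<in>{\<beta>\<in>?A (Suc k). \<beta> i > 0}. c (down i \<beta>) * ?m y \<beta>)"
      proof (rule sum.reindex_bij_witness[where i = "down i" and j = "\<lambda>\<beta>. \<beta>(i := Suc (\<beta> i))"])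
        fix \<beta> assume "\<beta> \<in> ?A k"
        then show "\<beta>(i := Suc (\<beta> i)) \<in> {\<beta>\<in>?A (Suc k). \<beta> i > 0}"
          using sum_upd[of \<beta> i "Suc (\<beta> i)"] by (simp add: multi_indices_def)
        have "?m y (\<beta>(i := Suc (\<beta> i))) = y i * ?m y \<beta>"
          by (simp add: prod.remove[of UNIV i] mult_ac)
        then show "c (down i (\<beta>(i := Suc (\<beta> i)))) * ?m y (\<beta>(i := Suc (\<beta> i))) = c \<beta> * (y i * ?m y \<beta>)"
          by (simp add: down_def)
      qed (use down_A in \<open>auto simp: down_def\<close>)
      also have "\<dots> = (\<Sum>\<beta>\<in>?A (Suc k). if \<beta> i > 0 then c (down i \<beta>) * ?m y \<beta> else 0)"
        by (rule sum.inter_filter) (rule finite_multi_indices)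
      finally show ?thesis by (simp add: if_distrib if_distribR cong: if_cong)
    qed
    have const: "B * (\<Sum>\<beta>\<in>?A k. c \<beta> * ?m y \<beta>) =
        (\<Sum>\<beta>\<in>?A (Suc k). (if \<beta> \<in> ?A k then B * c \<beta> else 0) * ?m y \<beta>)"
      unfolding sum_distrib_left
      by (rule sum.mono_neutral_cong_left) (use sub finite_multi_indices in auto)
    have "(B + sum y UNIV) ^ Suc k =
        B * (\<Sum>\<beta>\<in>?A k. c \<beta> * ?m y \<beta>) + (\<Sum>i\<in>UNIV. y i * (\<Sum>\<beta>\<in>?A k. c \<beta> * ?m y \<beta>))"
      by (simp add: c distrib_right sum_distrib_right)
    also have "\<dots> = (\<Sum>\<beta>\<in>?A (Suc k). c' \<beta> * ?m y \<beta>)"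
      unfolding shift const c'_def
      by (subst sum.swap) (simp add: distrib_right sum.distrib sum_distrib_right)
    finally show ?thesis .
  qed
  ultimately show ?case by blast
qed

text \<open>
  Expand the powers of \<open>B + \<alpha> \<bullet> x\<close> in monomials of \<open>x\<close>: the coefficient of the \<open>\<gamma>\<close>-th monomial is
  a positive constant times the product of the \<open>\<alpha> i ^ \<gamma> i\<close>. Taking the mixed finite difference of order
  \<open>\<beta>\<close> with respect to \<open>\<alpha>\<close> at \<open>0\<close> kills every \<open>\<gamma>\<close> that does not dominate \<open>\<beta>\<close> and keeps \<open>\<beta>\<close>
  itself. The remaining \<open>\<gamma>\<close> have larger total degree, so downward induction on the degree of \<open>\<beta>\<close>
  isolates the \<open>\<beta>\<close>-th monomial. The difference only involves \<open>\<alpha> \<le> \<beta>\<close>, which stays within the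
  multi-indices of degree at most \<open>k\<close>; hence as many powers suffice as there are monomials.
\<close>

lemma monomial_in_span_of_powers:
  fixes B :: real and \<beta> :: "'n::finite \<Rightarrow> nat"
  assumes B: "B > 0" and \<beta>: "\<beta> \<in> multi_indices k"
  shows "\<exists>w. \<forall>x :: real ^ 'n. (\<Prod>i\<in>UNIV. (x $ i) ^ \<beta> i) =
           (\<Sum>\<alpha>\<in>multi_indices k. w \<alpha> * (B + (\<Sum>i\<in>UNIV. real (\<alpha> i) * x $ i)) ^ k)"
  using \<beta>
proof (induction "k - sum \<beta> UNIV" arbitrary: \<beta> rule: less_induct)
  case less
  let ?A = "multi_indices k :: ('n \<Rightarrow> nat) set"
  let ?mon = "\<lambda>(x :: real ^ 'n) \<beta>. \<Prod>i\<in>UNIV. (x $ i) ^ \<beta> i"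
  let ?g = "\<lambda>\<alpha> (x :: real ^ 'n). B + (\<Sum>i\<in>UNIV. real (\<alpha> i) * x $ i)"
  obtain c where c_pos: "\<And>\<beta>. \<beta> \<in> ?A \<Longrightarrow> c \<beta> > 0"
    and c: "\<And>y :: 'n \<Rightarrow> real. (B + sum y UNIV) ^ k = (\<Sum>\<beta>\<in>?A. c \<beta> * (\<Prod>i\<in>UNIV. y i ^ \<beta> i))"
    using power_of_sum_expansion[OF B] by blast
  define s where "s \<gamma> = (\<Prod>i\<in>UNIV. fact (\<beta> i) * real (Stirling (\<gamma> i) (\<beta> i)))" for \<gamma> :: "'n \<Rightarrow> nat"
  \<comment> \<open>The weights of the mixed finite difference of order \<open>\<beta>\<close>; they vanish unless \<open>\<alpha> \<le> \<beta>\<close>.\<close>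
  define \<Delta> where "\<Delta> \<alpha> = (\<Prod>i\<in>UNIV. (- 1) ^ (\<beta> i + \<alpha> i) * real (\<beta> i choose \<alpha> i))" for \<alpha>
  have \<Delta>_mon: "(\<Sum>\<alpha>\<in>?A. \<Delta> \<alpha> * (\<Prod>i\<in>UNIV. real (\<alpha> i) ^ \<gamma> i)) = s \<gamma>" for \<gamma>
  proof -
    have "s \<gamma> = (\<Prod>i\<in>UNIV. \<Sum>a\<in>{..\<beta> i}. (- 1) ^ (\<beta> i + a) * real (\<beta> i choose a) * real a ^ \<gamma> i)"
      by (simp add: s_def alternating_binomial_power_sum)
    also have "\<dots> = (\<Sum>\<alpha>\<in>(\<Pi>\<^sub>E i\<in>UNIV. {..\<beta> i}). \<Prod>i\<in>UNIV. (- 1) ^ (\<beta> i + \<alpha> i) * real (\<beta> i choose \<alpha> i) * real (\<alpha> i) ^ \<gamma> i)"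
      by (rule prod_sum_PiE) auto
    also have "\<dots> = (\<Sum>\<alpha>\<in>(\<Pi>\<^sub>E i\<in>UNIV. {..\<beta> i}). \<Delta> \<alpha> * (\<Prod>i\<in>UNIV. real (\<alpha> i) ^ \<gamma> i))"
      by (simp add: \<Delta>_def prod.distrib)
    also have "\<dots> = (\<Sum>\<alpha>\<in>?A. \<Delta> \<alpha> * (\<Prod>i\<in>UNIV. real (\<alpha> i) ^ \<gamma> i))"
    proof (rule sum.mono_neutral_left[OF finite_multi_indices])
      show "(\<Pi>\<^sub>E i\<in>UNIV. {..\<beta> i}) \<subseteq> ?A"
        using less.prems by (auto simp: multi_indices_def PiE_def Pi_def intro: order_trans[OF sum_mono])
      show "\<forall>\<alpha>\<in>?A - (\<Pi>\<^sub>E i\<in>UNIV. {..\<beta> i}). \<Delta> \<alpha> * (\<Prod>i\<in>UNIV. real (\<alpha> i) ^ \<gamma> i) = 0"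
        by (auto simp: \<Delta>_def PiE_def Pi_def not_le intro: binomial_eq_0)
    qed
    finally show ?thesis by simp
  qed
  have diff: "(\<Sum>\<alpha>\<in>?A. \<Delta> \<alpha> * ?g \<alpha> x ^ k) = (\<Sum>\<gamma>\<in>?A. c \<gamma> * s \<gamma> * ?mon x \<gamma>)" for x
  proof -
    have "(\<Sum>\<alpha>\<in>?A. \<Delta> \<alpha> * ?g \<alpha> x ^ k) =
        (\<Sum>\<alpha>\<in>?A. \<Sum>\<gamma>\<in>?A. \<Delta> \<alpha> * (c \<gamma> * ((\<Prod>i\<in>UNIV. real (\<alpha> i) ^ \<gamma> i) * ?mon x \<gamma>)))"
      by (simp add: c sum_distrib_left power_mult_distrib prod.distrib)
    also have "\<dots> = (\<Sum>\<gamma>\<in>?A. c \<gamma> * (\<Sum>\<alpha>\<in>?A. \<Delta> \<alpha> * (\<Prod>i\<in>UNIV. real (\<alpha> i) ^ \<gamma> i)) * ?mon x \<gamma>)"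
      by (subst sum.swap) (simp add: sum_distrib_left sum_distrib_right mult_ac)
    finally show ?thesis by (simp add: \<Delta>_mon)
  qed
  have higher: "\<exists>w. \<forall>x. s \<gamma> * ?mon x \<gamma> = (\<Sum>\<alpha>\<in>?A. w \<alpha> * ?g \<alpha> x ^ k)"
    if \<gamma>: "\<gamma> \<in> ?A - {\<beta>}" for \<gamma>
  proof (cases "\<forall>i. \<beta> i \<le> \<gamma> i")
    case True
    moreover obtain j where "\<beta> j \<noteq> \<gamma> j" using \<gamma> by (metis DiffE ext singletonI)
    ultimately have "sum \<beta> UNIV < sum \<gamma> UNIV"
      by (intro sum_strict_mono_ex1) (auto simp: order.strict_iff_order)
    moreover have "sum \<gamma> UNIV \<le> k" using \<gamma> by (simp add: multi_indices_def)
    ultimately have "k - sum \<gamma> UNIV < k - sum \<beta> UNIV" by linarith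
    then obtain w where "\<forall>x. ?mon x \<gamma> = (\<Sum>\<alpha>\<in>?A. w \<alpha> * ?g \<alpha> x ^ k)"
      using less.hyps[of \<gamma>] \<gamma> by blast
    then show ?thesis
      by (intro exI[of _ "\<lambda>\<alpha>. s \<gamma> * w \<alpha>"]) (simp add: sum_distrib_left mult_ac)
  next
    case False
    then obtain i where "\<gamma> i < \<beta> i" by (auto simp: not_le)
    then have "Stirling (\<gamma> i) (\<beta> i) = 0" by simp
    then have "s \<gamma> = 0" by (auto simp: s_def)
    then show ?thesis by (intro exI[of _ "\<lambda>_. 0"]) simp
  qed
  then have "\<forall>\<gamma>\<in>?A - {\<beta>}. \<exists>w. \<forall>x. s \<gamma> * ?mon x \<gamma> = (\<Sum>\<alpha>\<in>?A. w \<alpha> * ?g \<alpha> x ^ k)"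
    by (rule ballI)
  then obtain W where W_all: "\<forall>\<gamma>\<in>?A - {\<beta>}. \<forall>x. s \<gamma> * ?mon x \<gamma> = (\<Sum>\<alpha>\<in>?A. W \<gamma> \<alpha> * ?g \<alpha> x ^ k)"
    unfolding bchoice_iff by (elim exE)
  have W: "s \<gamma> * ?mon x \<gamma> = (\<Sum>\<alpha>\<in>?A. W \<gamma> \<alpha> * ?g \<alpha> x ^ k)" if "\<gamma> \<in> ?A - {\<beta>}" for \<gamma> x
    by (rule bspec[OF W_all that, THEN spec])
  have nz: "c \<beta> * s \<beta> \<noteq> 0"
    using c_pos[OF less.prems] by (simp add: s_def)
  define w where "w \<alpha> = (\<Delta> \<alpha> - (\<Sum>\<gamma>\<in>?A - {\<beta>}. c \<gamma> * W \<gamma> \<alpha>)) / (c \<beta> * s \<beta>)" for \<alpha>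
  have "?mon x \<beta> = (\<Sum>\<alpha>\<in>?A. w \<alpha> * ?g \<alpha> x ^ k)" for x
  proof -
    have "(\<Sum>\<gamma>\<in>?A - {\<beta>}. c \<gamma> * s \<gamma> * ?mon x \<gamma>) =
        (\<Sum>\<gamma>\<in>?A - {\<beta>}. c \<gamma> * (\<Sum>\<alpha>\<in>?A. W \<gamma> \<alpha> * ?g \<alpha> x ^ k))"
      by (intro sum.cong refl) (simp only: W mult.assoc)
    also have "\<dots> = (\<Sum>\<alpha>\<in>?A. (\<Sum>\<gamma>\<in>?A - {\<beta>}. c \<gamma> * W \<gamma> \<alpha>) * ?g \<alpha> x ^ k)"
      by (simp add: sum_distrib_left sum_distrib_right mult.assoc) (rule sum.swap)
    finally have "c \<beta> * s \<beta> * ?mon x \<beta> =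
        (\<Sum>\<alpha>\<in>?A. \<Delta> \<alpha> * ?g \<alpha> x ^ k) - (\<Sum>\<alpha>\<in>?A. (\<Sum>\<gamma>\<in>?A - {\<beta>}. c \<gamma> * W \<gamma> \<alpha>) * ?g \<alpha> x ^ k)"
      unfolding diff using sum.remove[OF finite_multi_indices less.prems, of "\<lambda>\<gamma>. c \<gamma> * s \<gamma> * ?mon x \<gamma>"]
      by simp
    also have "\<dots> = (\<Sum>\<alpha>\<in>?A. c \<beta> * s \<beta> * (w \<alpha> * ?g \<alpha> x ^ k))"
      unfolding sum_subtractf[symmetric] left_diff_distrib[symmetric]
      by (intro sum.cong refl) (use nz in \<open>simp add: w_def\<close>)
    finally show ?thesis
      using nz by (simp flip: sum_distrib_left)
  qed
  then show ?case by blast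
qed

section \<open>Barycentric coordinates and facet hyperplanes\<close>

lemma affine_function_inner:
  assumes "affine_function (f :: 'a::euclidean_space \<Rightarrow> real)"
  shows "\<exists>a b. \<forall>x. f x = a \<bullet> x + b"
proof -
  have lin: "linear (\<lambda>x. f x - f 0)" using assms by (simp add: affine_function_def)
  have "f x = adjoint (\<lambda>x. f x - f 0) 1 \<bullet> x + f 0" for x
    using adjoint_works[OF lin, of x 1] by (simp add: inner_commute)
  then show ?thesis by blast
qed

text \<open>
  Shifting any \<open>x\<close> by a multiple of \<open>x0 - y\<close> brings it into the common zero set, which determines
  the first form at \<open>x\<close> from its value at \<open>y\<close>.
\<close>

lemma proportional_of_same_zero_set:
  fixes a a' :: "'a::euclidean_space"
  assumes zeros: "{x. a \<bullet> x + b = 0} = {x. a' \<bullet> x + b' = 0}"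
    and zero: "a' \<bullet> x0 + b' = 0" and nonzero: "a' \<bullet> y + b' \<noteq> 0"
  shows "\<exists>s. s \<noteq> 0 \<and> (\<forall>x. a \<bullet> x + b = s * (a' \<bullet> x + b'))"
proof -
  let ?f = "\<lambda>x. a \<bullet> x + b" and ?g = "\<lambda>x. a' \<bullet> x + b'"
  have z: "?f x = 0 \<longleftrightarrow> ?g x = 0" for x using zeros by blast
  define s where "s = ?f y / ?g y"
  have "?f x = s * ?g x" for x
  proof -
    define u where "u = x + (?g x / ?g y) *\<^sub>R (x0 - y)"
    have "?g u = ?g x + (?g x / ?g y) * (?g x0 - ?g y)"
      by (simp add: u_def inner_add_right inner_diff_right)
    also have "\<dots> = 0"
    proof -
      have "t + t / r * (0 - r) = 0" if "r \<noteq> 0" for t r :: real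
        using that by simp
      then show ?thesis unfolding zero using nonzero .
    qed
    finally have "?g u = 0" .
    then have "?f u = 0" by (simp add: z)
    moreover have "?f u = ?f x + (?g x / ?g y) * (?f x0 - ?f y)"
      by (simp add: u_def inner_add_right inner_diff_right)
    moreover have "?f x0 = 0" using zero z by blast
    ultimately have "?f x + (?g x / ?g y) * (0 - ?f y) = 0" by (simp only:)
    moreover have "p = q / r * t" if "p + t / r * (0 - q) = 0" for p q r t :: real
      using that by (simp add: mult.commute)
    ultimately show ?thesis unfolding s_def by blast
  qed
  moreover have "s \<noteq> 0" using nonzero z[of y] by (simp add: s_def)
  ultimately show ?thesis by blast
qed

context
  fixes \<tau> :: "'a::euclidean_space set"
  assumes \<tau>: "open_simplex \<tau>"
begin

lemma affine_function_bary: "v \<in> vertices \<tau> \<Longrightarrow> affine_function (bary \<tau> v)"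
  and bary_vertex: "v \<in> vertices \<tau> \<Longrightarrow> w \<in> vertices \<tau> \<Longrightarrow> bary \<tau> v w = (if w = v then 1 else 0)"
  using theI'[OF bary_ex1[OF \<tau>], of v] unfolding bary_def by blast+

lemma finite_vertices: "finite (vertices \<tau>)"
  using vertices_open_simplex[OF \<tau>] by metis

text \<open>
  Write \<open>x\<close> as an affine combination of the vertices. Each barycentric coordinate is affine, so its
  value at \<open>x\<close> is the corresponding weight.
\<close>

lemma bary_expansion:
  shows "(\<Sum>v\<in>vertices \<tau>. bary \<tau> v x) = 1" and "(\<Sum>v\<in>vertices \<tau>. bary \<tau> v x *\<^sub>R v) = x"
proof -
  have hull: "affine hull vertices \<tau> = UNIV" using vertices_open_simplex[OF \<tau>] by metis
  then have "x \<in> affine hull vertices \<tau>" by simp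
  then obtain u where u: "sum u (vertices \<tau>) = 1" "(\<Sum>v\<in>vertices \<tau>. u v *\<^sub>R v) = x"
    unfolding affine_hull_finite[OF finite_vertices] by auto
  have "bary \<tau> v x = u v" if v: "v \<in> vertices \<tau>" for v
  proof -
    obtain a b where ab: "\<And>x. bary \<tau> v x = a \<bullet> x + b"
      using affine_function_inner[OF affine_function_bary[OF v]] by blast
    have "bary \<tau> v x = (\<Sum>w\<in>vertices \<tau>. u w * (a \<bullet> w)) + (\<Sum>w\<in>vertices \<tau>. u w * b)"
      unfolding ab by (simp flip: u(2) sum_distrib_right add: u(1) inner_sum_right)
    also have "\<dots> = (\<Sum>w\<in>vertices \<tau>. u w * bary \<tau> v w)"
      by (simp add: ab distrib_left sum.distrib)
    also have "\<dots> = (\<Sum>w\<in>vertices \<tau>. if w = v then u w else 0)"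
      by (intro sum.cong refl) (simp add: bary_vertex v)
    finally show ?thesis using v finite_vertices by simp
  qed
  then show "(\<Sum>v\<in>vertices \<tau>. bary \<tau> v x) = 1" "(\<Sum>v\<in>vertices \<tau>. bary \<tau> v x *\<^sub>R v) = x"
    using u by simp_all
qed

lemma affine_combination_bary:
  "a \<bullet> x + b = (\<Sum>v\<in>vertices \<tau>. (a \<bullet> v + b) * bary \<tau> v x)"
proof -
  have "a \<bullet> x + b = a \<bullet> (\<Sum>v\<in>vertices \<tau>. bary \<tau> v x *\<^sub>R v) + b * (\<Sum>v\<in>vertices \<tau>. bary \<tau> v x)"
    by (simp add: bary_expansion)
  then show ?thesis
    by (simp add: inner_sum_right sum_distrib_left sum.distrib algebra_simps)
qed

lemma half_open_cell_subset_closure: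
  assumes "I \<subseteq> vertices \<tau>"
  shows "half_open_cell \<tau> I \<subseteq> closure \<tau>"
proof
  fix x assume x: "x \<in> half_open_cell \<tau> I"
  have cl: "closure \<tau> = convex hull vertices \<tau>" using vertices_open_simplex[OF \<tau>] by metis
  have "bary \<tau> v x \<ge> 0" if "v \<in> vertices \<tau>" for v
    using x that by (cases "v \<in> I") (auto simp: half_open_cell_def less_imp_le)
  then show "x \<in> closure \<tau>"
    unfolding cl convex_hull_finite[OF finite_vertices]
    using bary_expansion[of x] by (intro CollectI exI[of _ "\<lambda>v. bary \<tau> v x"]) simp
qed

text \<open>
  The facet is the one opposite to \<open>v\<close>. A second vertex exists because the dimension is positive;
  it witnesses that the zero set is nonempty.
\<close>

lemma bary_zero_set_facet_hyperplane:
  assumes v: "v \<in> vertices \<tau>"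
  obtains F where "F facet_of closure \<tau>" "affine hull F = {x. bary \<tau> v x = 0}"
    and "\<exists>w\<in>vertices \<tau>. w \<noteq> v"
proof -
  obtain C where C: "\<not> affine_dependent C" "finite C" "card C = DIM('a) + 1"
    "closure \<tau> = convex hull C" "vertices \<tau> = C"
    using vertices_open_simplex[OF \<tau>] by metis
  have vC: "v \<in> C" using v C by simp
  have "card (C - {v}) \<noteq> 0" using C vC DIM_positive[where 'a='a] by simp
  then have ne: "C - {v} \<noteq> {}" by force
  have "(convex hull (C - {v})) facet_of closure \<tau>"
    unfolding C(4) facet_of_convex_hull_affine_independent[OF C(1)] using ne vC by auto
  moreover have "affine hull (convex hull (C - {v})) = {x. bary \<tau> v x = 0}"
  proof (intro equalityI subsetI CollectI)
    fix x assume "x \<in> affine hull (convex hull (C - {v}))"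
    then have x: "x \<in> affine hull (C - {v})" by simp
    show "bary \<tau> v x = 0"
      by (rule affine_function_eq_on_hull[OF affine_function_bary[OF v], where C = "C - {v}" and g = "\<lambda>_. 0", OF _ _ _ x])
        (use v C in \<open>auto simp: affine_function_def bary_vertex linear_zero\<close>)
  next
    fix x assume "x \<in> {x. bary \<tau> v x = 0}"
    then have "(\<Sum>w\<in>C - {v}. bary \<tau> w x) = 1" "(\<Sum>w\<in>C - {v}. bary \<tau> w x *\<^sub>R w) = x"
      using bary_expansion[of x] sum.remove[OF C(2) vC, of "\<lambda>w. bary \<tau> w x"]
        sum.remove[OF C(2) vC, of "\<lambda>w. bary \<tau> w x *\<^sub>R w"] C(5) by auto
    then have "x \<in> affine hull (C - {v})"
      using C(2) by (subst affine_hull_finite) auto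
    then show "x \<in> affine hull (convex hull (C - {v}))" by simp
  qed
  ultimately show ?thesis using that ne C(5) by blast
qed

end

text \<open>
  One equation is fixed for each hyperplane, so that elements sharing a facet hyperplane also share
  the corresponding neurons. The condition \<open>h \<noteq> UNIV\<close> rules out the zero normal for nonempty \<open>h\<close>.
\<close>

definition defining_form :: "'a::euclidean_space set \<Rightarrow> 'a \<times> real" where
  "defining_form h = (SOME (a, b). h = {x. a \<bullet> x + b = 0} \<and> h \<noteq> UNIV)"

lemma bary_multiple_of_defining_form:
  assumes \<T>: "\<forall>\<tau>\<in>\<T>. open_simplex \<tau>" and \<tau>: "\<tau> \<in> \<T>" and v: "v \<in> vertices \<tau>"
  obtains h s where "h \<in> facet_hyperplanes \<T>" "s \<noteq> 0"
    "\<And>x. bary \<tau> v x = s * (fst (defining_form h) \<bullet> x + snd (defining_form h))"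
proof -
  have simp\<tau>: "open_simplex \<tau>" using \<T> \<tau> by blast
  define h where "h = {x. bary \<tau> v x = 0}"
  obtain F w where F: "F facet_of closure \<tau>" "affine hull F = h" and w: "w \<in> vertices \<tau>" "w \<noteq> v"
    using bary_zero_set_facet_hyperplane[OF simp\<tau> v] unfolding h_def by metis
  obtain a b where ab: "\<And>x. bary \<tau> v x = a \<bullet> x + b"
    using affine_function_inner[OF affine_function_bary[OF simp\<tau> v]] by blast
  have wh: "w \<in> h" and vh: "v \<notin> h" using w v simp\<tau> by (auto simp: h_def bary_vertex)
  have "\<exists>p. case p of (a, b) \<Rightarrow> h = {x. a \<bullet> x + b = 0} \<and> h \<noteq> UNIV"
    using vh by (intro exI[of _ "(a, b)"]) (auto simp: h_def ab)
  then have "case defining_form h of (a, b) \<Rightarrow> h = {x. a \<bullet> x + b = 0} \<and> h \<noteq> UNIV"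
    unfolding defining_form_def by (rule someI_ex)
  then have df: "h = {x. fst (defining_form h) \<bullet> x + snd (defining_form h) = 0}"
    by (simp add: split_beta)
  have "\<exists>s. s \<noteq> 0 \<and> (\<forall>x. a \<bullet> x + b = s * (fst (defining_form h) \<bullet> x + snd (defining_form h)))"
  proof (rule proportional_of_same_zero_set)
    show "{x. a \<bullet> x + b = 0} = {x. fst (defining_form h) \<bullet> x + snd (defining_form h) = 0}"
      using df by (simp add: h_def ab)
  qed (use wh vh df in auto)
  then show ?thesis
    using that[of h] F \<tau> unfolding ab facet_hyperplanes_def by blast
qed

lemma finite_facet_hyperplanes:
  fixes \<T> :: "'a::euclidean_space set set"
  assumes "finite \<T>" and "\<forall>\<tau>\<in>\<T>. open_simplex \<tau>"
  shows "finite (facet_hyperplanes \<T>)"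
proof -
  have "facet_hyperplanes \<T> = (\<Union>\<tau>\<in>\<T>. (hull) affine ` {F. F facet_of closure \<tau>})"
    by (auto simp: facet_hyperplanes_def)
  moreover have "finite {F. F facet_of closure \<tau>}" if "\<tau> \<in> \<T>" for \<tau>
  proof (rule finite_polytope_facets)
    show "polytope (closure \<tau>)"
      using vertices_open_simplex[of \<tau>] assms(2) that unfolding polytope_def by metis
  qed
  ultimately show ?thesis using assms(1) by simp
qed

section \<open>Functions available to the second layer\<close>

lemma rho_if: "rho k t = (if t > 0 then t ^ k else 0)"
  by (simp add: rho_def)

text \<open>
  Neurons are most naturally indexed by geometric data; enumerating the index sets turns such a
  description into weight matrices. The hidden parameters come before the quantifier over the output
  coefficients \<open>W\<close>, as the dependence claim demands.
\<close>

lemma network_from_indexed_neurons: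
  fixes a :: "'p \<Rightarrow> real ^ 'n" and U0 U1 :: "'q \<Rightarrow> 'p \<Rightarrow> real"
  assumes P: "finite P" "card P = n1" and Q: "finite Q" "card Q = n2"
  shows "\<exists>W1 b1 W20 W21 b2. \<forall>m W. \<exists>W3. \<forall>x j. network m k n1 n2 W1 b1 W20 W21 b2 W3 x j =
       (if j < m then \<Sum>q\<in>Q. W j q * rho k ((\<Sum>p\<in>P. U0 q p * rho 0 (a p \<bullet> x + b p)) +
          (\<Sum>p\<in>P. U1 q p * rho 1 (a p \<bullet> x + b p)) + c q) else 0)"
proof -
  obtain \<phi> where \<phi>: "bij_betw \<phi> {..<n1} P"
    using ex_bij_betw_nat_finite[OF P(1)] P(2) by (auto simp: atLeast0LessThan)
  obtain \<psi> where \<psi>: "bij_betw \<psi> {..<n2} Q"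
    using ex_bij_betw_nat_finite[OF Q(1)] Q(2) by (auto simp: atLeast0LessThan)
  have sumP: "sum f P = (\<Sum>i<n1. f (\<phi> i))" for f :: "'p \<Rightarrow> real"
    by (rule sum.reindex_bij_betw[OF \<phi>, symmetric])
  have sumQ: "sum f Q = (\<Sum>l<n2. f (\<psi> l))" for f :: "'q \<Rightarrow> real"
    by (rule sum.reindex_bij_betw[OF \<psi>, symmetric])
  have net: "\<exists>W3. \<forall>x j. network m k n1 n2 (a \<circ> \<phi>) (b \<circ> \<phi>) (\<lambda>l i. U0 (\<psi> l) (\<phi> i))
      (\<lambda>l i. U1 (\<psi> l) (\<phi> i)) (c \<circ> \<psi>) W3 x j =
     (if j < m then \<Sum>q\<in>Q. W j q * rho k ((\<Sum>p\<in>P. U0 q p * rho 0 (a p \<bullet> x + b p)) +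
        (\<Sum>p\<in>P. U1 q p * rho 1 (a p \<bullet> x + b p)) + c q) else 0)" for m W
    by (intro exI[of _ "\<lambda>j l. W j (\<psi> l)"]) (simp add: network_def sumP sumQ)
  show ?thesis by ((rule exI)+, (rule allI)+, rule net)
qed

text \<open>
  The functions that one neuron of the second layer can receive as input when the first layer has
  the neurons \<open>p \<in> P\<close> with weights \<open>a p\<close> and biases \<open>b p\<close>. The two sums use the two activations of
  the same neuron.
\<close>

definition preactivations ::
    "'p set \<Rightarrow> ('p \<Rightarrow> 'a::euclidean_space) \<Rightarrow> ('p \<Rightarrow> real) \<Rightarrow> ('a \<Rightarrow> real) set" where
  "preactivations P a b = {f. \<exists>U0 U1 c. \<forall>x. f x =
     (\<Sum>p\<in>P. U0 p * rho 0 (a p \<bullet> x + b p)) + (\<Sum>p\<in>P. U1 p * rho 1 (a p \<bullet> x + b p)) + c}"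

lemma preactivations_const: "(\<lambda>_. c) \<in> preactivations P a b"
  unfolding preactivations_def
  by (intro CollectI exI[of _ "\<lambda>_. 0"] exI[of _ c]) simp

lemma preactivations_add:
  assumes "f \<in> preactivations P a b" "g \<in> preactivations P a b"
  shows "(\<lambda>x. f x + g x) \<in> preactivations P a b"
proof -
  obtain U0 U1 c V0 V1 d where
    f: "\<And>x. f x = (\<Sum>p\<in>P. U0 p * rho 0 (a p \<bullet> x + b p)) + (\<Sum>p\<in>P. U1 p * rho 1 (a p \<bullet> x + b p)) + c" and
    g: "\<And>x. g x = (\<Sum>p\<in>P. V0 p * rho 0 (a p \<bullet> x + b p)) + (\<Sum>p\<in>P. V1 p * rho 1 (a p \<bullet> x + b p)) + d"
    using assms unfolding preactivations_def by auto
  show ?thesis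
    unfolding preactivations_def
    by (intro CollectI exI[of _ "\<lambda>p. U0 p + V0 p"] exI[of _ "\<lambda>p. U1 p + V1 p"] exI[of _ "c + d"])
      (simp add: f g distrib_right sum.distrib)
qed

lemma preactivations_scale:
  assumes "f \<in> preactivations P a b"
  shows "(\<lambda>x. t * f x) \<in> preactivations P a b"
proof -
  obtain U0 U1 c where
    f: "\<And>x. f x = (\<Sum>p\<in>P. U0 p * rho 0 (a p \<bullet> x + b p)) + (\<Sum>p\<in>P. U1 p * rho 1 (a p \<bullet> x + b p)) + c"
    using assms unfolding preactivations_def by auto
  show ?thesis
    unfolding preactivations_def
    by (intro CollectI exI[of _ "\<lambda>p. t * U0 p"] exI[of _ "\<lambda>p. t * U1 p"] exI[of _ "t * c"])
      (simp add: f distrib_left sum_distrib_left mult.assoc)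
qed

lemma preactivations_sum:
  assumes "\<And>i. i \<in> J \<Longrightarrow> f i \<in> preactivations P a b"
  shows "(\<lambda>x. \<Sum>i\<in>J. f i x) \<in> preactivations P a b"
  using assms
  by (induction J rule: infinite_finite_induct) (auto intro: preactivations_const preactivations_add)

lemma preactivations_neuron:
  assumes P: "finite P" "p \<in> P"
  shows "(\<lambda>x. rho 0 (a p \<bullet> x + b p)) \<in> preactivations P a b"
    and "(\<lambda>x. rho 1 (a p \<bullet> x + b p)) \<in> preactivations P a b"
proof -
  have delta: "(\<Sum>q\<in>P. (if q = p then 1 else 0) * f q) = (f p :: real)" for f
    using P by (simp add: if_distrib if_distribR cong: if_cong)
  show "(\<lambda>x. rho 0 (a p \<bullet> x + b p)) \<in> preactivations P a b"
    unfolding preactivations_def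
    by (intro CollectI exI[of _ "\<lambda>q. if q = p then 1 else 0"] exI[of _ "\<lambda>_. 0"] exI[of _ 0])
      (simp only: delta, simp)
  show "(\<lambda>x. rho 1 (a p \<bullet> x + b p)) \<in> preactivations P a b"
    unfolding preactivations_def
    by (intro CollectI exI[of _ "\<lambda>q. if q = p then 1 else 0"] exI[of _ "\<lambda>_. 0"] exI[of _ 0])
      (simp only: delta, simp)
qed

text \<open>
  The first layer of the construction: every facet hyperplane contributes its defining form and the
  negative of that form. Both signs are needed, because the strict indicator of one side does not
  determine the strict indicator of the other side.
\<close>

abbreviation mesh_preactivations :: "'a::euclidean_space set set \<Rightarrow> ('a \<Rightarrow> real) set" where
  "mesh_preactivations \<T> \<equiv> preactivations (facet_hyperplanes \<T> \<times> {1, - 1})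
     (\<lambda>(h, s). s *\<^sub>R fst (defining_form h)) (\<lambda>(h, s). s * snd (defining_form h))"

text \<open>
  Up to a nonzero factor, a barycentric coordinate is the defining form \<open>l\<close> of a facet hyperplane.
  The two step neurons indicate \<open>l > 0\<close> and \<open>l < 0\<close>, and the two ramp neurons recover
  \<open>l = max l 0 - max (- l) 0\<close>.
\<close>

lemma mesh_preactivations_bary:
  fixes \<T> :: "'a::euclidean_space set set"
  assumes fin: "finite \<T>" and simplices: "\<forall>\<tau>\<in>\<T>. open_simplex \<tau>"
    and \<tau>: "\<tau> \<in> \<T>" and v: "v \<in> vertices \<tau>"
  shows "bary \<tau> v \<in> mesh_preactivations \<T>"
    and "(\<lambda>x. of_bool (bary \<tau> v x > 0)) \<in> mesh_preactivations \<T>"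
    and "(\<lambda>x. of_bool (bary \<tau> v x < 0)) \<in> mesh_preactivations \<T>"
proof -
  let ?P = "facet_hyperplanes \<T> \<times> {1, - 1 :: real}"
  obtain h s where h: "h \<in> facet_hyperplanes \<T>" and s: "s \<noteq> 0"
    and bary: "\<And>x. bary \<tau> v x = s * (fst (defining_form h) \<bullet> x + snd (defining_form h))"
    using bary_multiple_of_defining_form[OF simplices \<tau> v] by metis
  let ?l = "\<lambda>x. fst (defining_form h) \<bullet> x + snd (defining_form h)"
  have finP: "finite ?P" using finite_facet_hyperplanes[OF fin simplices] by simp
  have mem: "(h, 1) \<in> ?P" "(h, - 1) \<in> ?P" using h by auto
  note neurons = preactivations_neuron[OF finP mem(1), of "\<lambda>(h, s). s *\<^sub>R fst (defining_form h)" "\<lambda>(h, s). s * snd (defining_form h)"]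
    preactivations_neuron[OF finP mem(2), of "\<lambda>(h, s). s *\<^sub>R fst (defining_form h)" "\<lambda>(h, s). s * snd (defining_form h)"]
  have pos: "(\<lambda>x. of_bool (?l x > 0)) \<in> mesh_preactivations \<T>"
    using neurons(1) by (simp add: rho_def of_bool_def)
  have neg: "(\<lambda>x. of_bool (?l x < 0)) \<in> mesh_preactivations \<T>"
  proof -
    have "(\<lambda>x. of_bool (?l x < 0)) = (\<lambda>x. rho 0 (- (fst (defining_form h) \<bullet> x) - snd (defining_form h)))"
      by (auto simp: rho_def fun_eq_iff)
    then show ?thesis using neurons(3) by simp
  qed
  have "bary \<tau> v = (\<lambda>x. s * rho 1 (?l x) + (- s) * rho 1 (- (fst (defining_form h) \<bullet> x) - snd (defining_form h)))"
  proof
    fix x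
    have split: "t = rho 1 t - rho 1 (- t)" for t by (simp add: rho_def)
    show "bary \<tau> v x = s * rho 1 (?l x) + (- s) * rho 1 (- (fst (defining_form h) \<bullet> x) - snd (defining_form h))"
      using arg_cong[OF split[of "?l x"], of "\<lambda>t. s * t"] by (simp add: bary right_diff_distrib)
  qed
  then show "bary \<tau> v \<in> mesh_preactivations \<T>"
    using preactivations_add[OF preactivations_scale[OF neurons(2), of s] preactivations_scale[OF neurons(4), of "- s"]]
    by simp
  show "(\<lambda>x. of_bool (bary \<tau> v x > 0)) \<in> mesh_preactivations \<T>"
    using s pos neg by (cases "s > 0") (simp_all add: bary zero_less_mult_iff not_less)
  show "(\<lambda>x. of_bool (bary \<tau> v x < 0)) \<in> mesh_preactivations \<T>"
    using s pos neg by (cases "s > 0") (simp_all add: bary mult_less_0_iff not_less)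
qed

text \<open>
  The barycentric coordinates of one element span all affine functions, so \<open>a \<bullet> x + b\<close> is
  available from the neurons of its facets alone. Subtract \<open>K\<close> once for each violated inequality of the
  half-open cell: nothing changes on the cell, and off the cell the bound \<open>K\<close> makes the result
  nonpositive. Whether a weak or a strict inequality is violated is an indicator of \<open>bary < 0\<close> or the
  complement of an indicator of \<open>bary > 0\<close>, both of which the first layer provides exactly, also on
  the hyperplanes.
\<close>

lemma half_open_gate:
  fixes \<T> :: "'a::euclidean_space set set"
  assumes fin: "finite \<T>" and simplices: "\<forall>\<tau>\<in>\<T>. open_simplex \<tau>"
    and \<tau>: "\<tau> \<in> \<T>" and I: "I \<subseteq> vertices \<tau>"
    and "K \<ge> 0" and bound: "\<And>x. x \<in> S \<Longrightarrow> a \<bullet> x + b \<le> K"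
  shows "\<exists>f\<in>mesh_preactivations \<T>.
           (\<forall>x\<in>half_open_cell \<tau> I. f x = a \<bullet> x + b) \<and> (\<forall>x\<in>S - half_open_cell \<tau> I. f x \<le> 0)"
proof -
  let ?V = "vertices \<tau>"
  have simp\<tau>: "open_simplex \<tau>" using simplices \<tau> by blast
  have finV: "finite ?V" by (rule finite_vertices[OF simp\<tau>])
  note bary_mem = mesh_preactivations_bary[OF fin simplices \<tau>]
  define viol where "viol v x = (if v \<in> I then of_bool (bary \<tau> v x < 0)
    else 1 + (- 1) * of_bool (bary \<tau> v x > 0) :: real)" for v x
  have viol_mem: "viol v \<in> mesh_preactivations \<T>" if "v \<in> ?V" for v
    using bary_mem(3)[OF that] preactivations_add[OF preactivations_const preactivations_scale[OF bary_mem(2)[OF that]]]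
    unfolding viol_def by (cases "v \<in> I") (simp_all only: if_True if_False)
  have viol_nonneg: "viol v x \<ge> 0" for v x by (simp add: viol_def)
  define f where "f x = a \<bullet> x + b + (- K) * (\<Sum>v\<in>?V. viol v x)" for x
  have "(\<lambda>x. a \<bullet> x + b) \<in> mesh_preactivations \<T>"
    by (subst affine_combination_bary[OF simp\<tau>]) (intro preactivations_sum preactivations_scale bary_mem(1))
  then have "f \<in> mesh_preactivations \<T>"
    unfolding f_def
    by (rule preactivations_add[OF _ preactivations_scale[OF preactivations_sum[OF viol_mem]]])
  moreover have "f x = a \<bullet> x + b" if "x \<in> half_open_cell \<tau> I" for x
  proof -
    have "viol v x = 0" if "v \<in> ?V" for v
      using that \<open>x \<in> half_open_cell \<tau> I\<close> by (auto simp: viol_def half_open_cell_def not_less)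
    then show ?thesis by (simp add: f_def)
  qed
  moreover have "f x \<le> 0" if x: "x \<in> S - half_open_cell \<tau> I" for x
  proof -
    obtain v where v: "v \<in> ?V" "viol v x = 1"
      using x I by (auto simp: viol_def half_open_cell_def not_le not_less)
    then have "(\<Sum>v\<in>?V. viol v x) \<ge> 1"
      using member_le_sum[OF v(1), of "\<lambda>v. viol v x"] viol_nonneg finV by auto
    then have "K * 1 \<le> K * (\<Sum>v\<in>?V. viol v x)"
      using \<open>K \<ge> 0\<close> by (rule mult_left_mono)
    then show ?thesis using bound[of x] x by (simp add: f_def)
  qed
  ultimately show ?thesis by blast
qed

section \<open>Piecewise polynomials as combinations of gated powers\<close>

text \<open>
  The powers do not depend on the polynomial nor on the coordinate \<open>j\<close>; this is why all components
  can share the hidden parameters.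
\<close>

lemma polynomial_coordinates_in_powers:
  fixes p :: "real ^ 'n \<Rightarrow> 'e::real_vector"
  assumes p: "p \<in> polynomials k E" and basis: "ordered_basis m e E" and B: "B > 0"
  shows "\<exists>W. \<forall>x. p x = (\<Sum>j<m. (\<Sum>\<alpha>\<in>multi_indices k.
           W j \<alpha> * (B + (\<Sum>i\<in>UNIV. real (\<alpha> i) * x $ i)) ^ k) *\<^sub>R e j)"
proof -
  let ?A = "multi_indices k :: ('n \<Rightarrow> nat) set"
  let ?g = "\<lambda>\<alpha> (x :: real ^ 'n). B + (\<Sum>i\<in>UNIV. real (\<alpha> i) * x $ i)"
  obtain c where c: "range c \<subseteq> E" and p_eq: "\<And>x. p x = (\<Sum>\<beta>\<in>?A. (\<Prod>i\<in>UNIV. (x $ i) ^ \<beta> i) *\<^sub>R c \<beta>)"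
    using p unfolding polynomials_def multi_indices_def by auto
  have "\<exists>r. c \<beta> = (\<Sum>j<m. r j *\<^sub>R e j)" for \<beta>
  proof -
    have "c \<beta> \<in> span (e ` {..<m})" using c basis by (auto simp: ordered_basis_def)
    then obtain u where "c \<beta> = (\<Sum>v\<in>e ` {..<m}. u v *\<^sub>R v)"
      by (auto simp: span_finite)
    also have "\<dots> = (\<Sum>j<m. u (e j) *\<^sub>R e j)"
      using basis by (subst sum.reindex) (auto simp: ordered_basis_def)
    finally show ?thesis by (rule exI[of _ "\<lambda>j. u (e j)"])
  qed
  then obtain r where r: "\<And>\<beta>. c \<beta> = (\<Sum>j<m. r \<beta> j *\<^sub>R e j)" by metis
  have "\<forall>\<beta>\<in>?A. \<exists>w. \<forall>x. (\<Prod>i\<in>UNIV. (x $ i) ^ \<beta> i) = (\<Sum>\<alpha>\<in>?A. w \<alpha> * ?g \<alpha> x ^ k)"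
    by (intro ballI monomial_in_span_of_powers[OF B])
  then obtain w where w: "\<forall>\<beta>\<in>?A. \<forall>x. (\<Prod>i\<in>UNIV. (x $ i) ^ \<beta> i) = (\<Sum>\<alpha>\<in>?A. w \<beta> \<alpha> * ?g \<alpha> x ^ k)"
    unfolding bchoice_iff by (elim exE)
  define W where "W j \<alpha> = (\<Sum>\<beta>\<in>?A. r \<beta> j * w \<beta> \<alpha>)" for j \<alpha>
  have "p x = (\<Sum>j<m. (\<Sum>\<alpha>\<in>?A. W j \<alpha> * ?g \<alpha> x ^ k) *\<^sub>R e j)" for x
  proof -
    have coord: "(\<Sum>\<beta>\<in>?A. r \<beta> j * (\<Prod>i\<in>UNIV. (x $ i) ^ \<beta> i)) = (\<Sum>\<alpha>\<in>?A. W j \<alpha> * ?g \<alpha> x ^ k)" for j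
    proof -
      have "(\<Sum>\<beta>\<in>?A. r \<beta> j * (\<Prod>i\<in>UNIV. (x $ i) ^ \<beta> i)) = (\<Sum>\<beta>\<in>?A. \<Sum>\<alpha>\<in>?A. r \<beta> j * w \<beta> \<alpha> * ?g \<alpha> x ^ k)"
        by (intro sum.cong refl) (simp only: bspec[OF w, THEN spec] sum_distrib_left mult.assoc)
      also have "\<dots> = (\<Sum>\<alpha>\<in>?A. W j \<alpha> * ?g \<alpha> x ^ k)"
        by (subst sum.swap) (simp add: W_def sum_distrib_right)
      finally show ?thesis .
    qed
    have "p x = (\<Sum>j<m. (\<Sum>\<beta>\<in>?A. r \<beta> j * (\<Prod>i\<in>UNIV. (x $ i) ^ \<beta> i)) *\<^sub>R e j)"
      unfolding p_eq r scaleR_sum_right scaleR_sum_left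
      by (subst sum.swap) (simp add: mult.commute)
    then show ?thesis by (simp only: coord)
  qed
  then show ?thesis by blast
qed

lemma continuous_on_polynomials:
  fixes p :: "real ^ 'n \<Rightarrow> 'e::real_normed_vector"
  assumes "p \<in> polynomials k E"
  shows "continuous_on S p"
proof -
  obtain c :: "('n \<Rightarrow> nat) \<Rightarrow> 'e" where
    "\<forall>x. p x = (\<Sum>\<alpha> | sum \<alpha> UNIV \<le> k. (\<Prod>i\<in>UNIV. (x $ i) ^ \<alpha> i) *\<^sub>R c \<alpha>)"
    using assms unfolding polynomials_def by blast
  then have "p = (\<lambda>x. \<Sum>\<alpha> | sum \<alpha> UNIV \<le> k. (\<Prod>i\<in>UNIV. (x $ i) ^ \<alpha> i) *\<^sub>R c \<alpha>)"
    by (intro ext) blast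
  then show ?thesis
    by (elim ssubst) (intro continuous_intros)
qed

text \<open>
  Polynomial pieces are prescribed on the open elements only, whereas half-open cells also contain
  boundary points; continuity of \<open>v\<close> bridges the gap.
\<close>

lemma pw_poly_space_on_closure:
  fixes v :: "real ^ 'n \<Rightarrow> 'e::real_normed_vector"
  assumes v: "v \<in> pw_poly_space k \<Omega> \<T> E" and \<tau>: "\<tau> \<in> \<T>" "closure \<tau> \<subseteq> closure \<Omega>"
  shows "\<exists>p\<in>polynomials k E. \<forall>x\<in>closure \<tau>. v x = p x"
proof -
  have cont: "continuous_on (closure \<Omega>) v" and "\<exists>p\<in>polynomials k E. \<forall>x\<in>\<tau>. v x = p x"
    using v \<tau>(1) by (simp_all add: pw_poly_space_def)
  then obtain p where p: "p \<in> polynomials k E" "\<forall>x\<in>\<tau>. v x = p x" by blast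
  have diff: "continuous_on (closure \<tau>) (\<lambda>x. v x - p x)"
    by (intro continuous_on_diff continuous_on_polynomials[OF p(1)] continuous_on_subset[OF cont \<tau>(2)])
  have "v x = p x" if "x \<in> closure \<tau>" for x
    using continuous_constant_on_closure[OF diff _ that, of 0] p(2) by simp
  then show ?thesis using p(1) by blast
qed

theorem theorem12:
  fixes \<Omega> :: "(real ^ 'n) set" and \<T> :: "(real ^ 'n) set set"
    and I :: "(real ^ 'n) set \<Rightarrow> (real ^ 'n) set" and k :: nat
  assumes "open \<Omega>" and "bounded \<Omega>" and "polyhedral_set \<Omega>"
    and "conforming_simplicial_mesh \<Omega> \<T>"
    and "half_open_decomposition \<Omega> \<T> I"
  shows "let n1 = 2 * card (facet_hyperplanes \<T>);
             n2 = ((CARD('n) + k) choose k) * card \<T>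
         in \<exists>W1 b1 W20 W21 b2.
              \<forall>m (E :: 'e::real_normed_vector set) e. 1 \<le> m \<longrightarrow> ordered_basis m e E \<longrightarrow>
                (\<forall>v\<in>pw_poly_space k \<Omega> \<T> E. \<exists>W3. \<exists>f\<in>NN m k n1 n2.
                   f = network m k n1 n2 W1 b1 W20 W21 b2 W3 \<and>
                   (\<forall>x\<in>closure \<Omega>. v x = (\<Sum>j<m. f x j *\<^sub>R e j)))"
proof -
  let ?n1 = "2 * card (facet_hyperplanes \<T>)" and ?n2 = "((CARD('n) + k) choose k) * card \<T>"
  let ?A = "multi_indices k :: ('n \<Rightarrow> nat) set"
  let ?P = "facet_hyperplanes \<T> \<times> {1, - 1 :: real}" and ?Q = "\<T> \<times> ?A"
  let ?a = "\<lambda>(h, s). s *\<^sub>R fst (defining_form h) :: real ^ 'n"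
  let ?b = "\<lambda>(h :: (real ^ 'n) set, s). s * snd (defining_form h)"
  let ?cell = "\<lambda>\<tau>. half_open_cell \<tau> (I \<tau>)"
  have fin: "finite \<T>" and simplices: "\<forall>\<tau>\<in>\<T>. open_simplex \<tau>"
    and cover: "(\<Union>\<tau>\<in>\<T>. closure \<tau>) = closure \<Omega>"
    using assms(4) by (auto simp: conforming_simplicial_mesh_def)
  have I: "\<And>\<tau>. \<tau> \<in> \<T> \<Longrightarrow> I \<tau> \<subseteq> vertices \<tau>" and disj: "disjoint_family_on ?cell \<T>"
    and cells: "closure \<Omega> = (\<Union>\<tau>\<in>\<T>. ?cell \<tau>)"
    using assms(5) by (auto simp: half_open_decomposition_def)
  have card_P: "card ?P = ?n1"
    by (simp add: card_cartesian_product)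
  have card_Q: "card ?Q = ?n2"
    by (simp add: card_cartesian_product card_multi_indices)
  have fin_P: "finite ?P" and fin_Q: "finite ?Q"
    using fin finite_facet_hyperplanes[OF fin simplices] finite_multi_indices by auto

  obtain R where R: "R > 0" "\<And>x. x \<in> closure \<Omega> \<Longrightarrow> norm x \<le> R"
    using bounded_closure[OF assms(2)] by (auto simp: bounded_pos)
  \<comment> \<open>This shift makes the affine functions \<open>?g \<alpha>\<close> below positive on the closure of \<open>\<Omega>\<close>.\<close>
  define B where "B = real k * R + 1"
  have B: "B > 0" using R(1) by (simp add: B_def add_nonneg_pos)
  let ?g = "\<lambda>\<alpha> (x :: real ^ 'n). B + (\<Sum>i\<in>UNIV. real (\<alpha> i) * x $ i)"
  have g_bounds: "?g \<alpha> x > 0" "?g \<alpha> x \<le> 2 * B"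
    if \<alpha>: "\<alpha> \<in> ?A" and x: "x \<in> closure \<Omega>" for \<alpha> x
  proof -
    have "\<bar>\<Sum>i\<in>UNIV. real (\<alpha> i) * x $ i\<bar> \<le> (\<Sum>i\<in>UNIV. real (\<alpha> i) * R)"
      using order_trans[OF component_le_norm_cart R(2)[OF x]]
      by (intro order_trans[OF sum_abs] sum_mono) (simp add: abs_mult mult_left_mono)
    also have "\<dots> = real (sum \<alpha> UNIV) * R" by (simp add: sum_distrib_right)
    also have "\<dots> \<le> real k * R" 
      using \<alpha> R(1) by (intro mult_right_mono) (simp_all add: multi_indices_def del: of_nat_sum)
    also have "\<dots> = B - 1" by (simp add: B_def)
    finally show "?g \<alpha> x > 0" "?g \<alpha> x \<le> 2 * B" using B by linarith+
  qed
  have "\<forall>q\<in>?Q. \<exists>f\<in>mesh_preactivations \<T>. (\<forall>x\<in>?cell (fst q). f x = ?g (snd q) x) \<and>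
      (\<forall>x\<in>closure \<Omega> - ?cell (fst q). f x \<le> 0)"
  proof
    fix q assume q: "q \<in> ?Q"
    have g_inner: "?g (snd q) x = (\<chi> i. real (snd q i)) \<bullet> x + B" for x
      by (simp add: inner_vec_def)
    show "\<exists>f\<in>mesh_preactivations \<T>. (\<forall>x\<in>?cell (fst q). f x = ?g (snd q) x) \<and>
        (\<forall>x\<in>closure \<Omega> - ?cell (fst q). f x \<le> 0)"
      unfolding g_inner
      by (rule half_open_gate[OF fin simplices _ I, where K = "2 * B"])
        (use q B g_bounds(2) in \<open>auto simp flip: g_inner\<close>)
  qed
  then have "\<exists>pre. \<forall>q\<in>?Q. pre q \<in> mesh_preactivations \<T> \<and>
      (\<forall>x\<in>?cell (fst q). pre q x = ?g (snd q) x) \<and> (\<forall>x\<in>closure \<Omega> - ?cell (fst q). pre q x \<le> 0)"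
    unfolding Bex_def bchoice_iff .
  then obtain pre where "\<forall>q\<in>?Q. pre q \<in> mesh_preactivations \<T> \<and>
      (\<forall>x\<in>?cell (fst q). pre q x = ?g (snd q) x) \<and> (\<forall>x\<in>closure \<Omega> - ?cell (fst q). pre q x \<le> 0)"
    by (elim exE)
  note pre = bspec[OF this]
  have pre_in: "pre q x = ?g (snd q) x" if "q \<in> ?Q" "x \<in> ?cell (fst q)" for q x
    using pre[OF that(1)] that(2) by blast
  have pre_out: "pre q x \<le> 0" if "q \<in> ?Q" "x \<in> closure \<Omega>" "x \<notin> ?cell (fst q)" for q x
    using pre[OF that(1)] that(2,3) by blast
  have "\<forall>q\<in>?Q. \<exists>U0 U1 c. \<forall>x. pre q x = (\<Sum>p\<in>?P. U0 p * rho 0 (?a p \<bullet> x + ?b p)) +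
      (\<Sum>p\<in>?P. U1 p * rho 1 (?a p \<bullet> x + ?b p)) + c"
    using pre[THEN conjunct1] unfolding preactivations_def mem_Collect_eq by (rule ballI)
  then obtain U0 U1 c where "\<forall>q\<in>?Q. \<forall>x. pre q x = (\<Sum>p\<in>?P. U0 q p * rho 0 (?a p \<bullet> x + ?b p)) +
      (\<Sum>p\<in>?P. U1 q p * rho 1 (?a p \<bullet> x + ?b p)) + c q"
    unfolding bchoice_iff by (elim exE)
  note U = bspec[OF this, THEN spec]
  obtain W1 b1 W20 W21 b2 where net: "\<forall>m W. \<exists>W3. \<forall>x j.
      network m k ?n1 ?n2 W1 b1 W20 W21 b2 W3 x j =
        (if j < m then \<Sum>q\<in>?Q. W j q * rho k ((\<Sum>p\<in>?P. U0 q p * rho 0 (?a p \<bullet> x + ?b p)) +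
          (\<Sum>p\<in>?P. U1 q p * rho 1 (?a p \<bullet> x + ?b p)) + c q) else 0)"
    using network_from_indexed_neurons[OF fin_P card_P fin_Q card_Q, of k U0 ?a ?b U1 c] by (elim exE)
  \<comment> \<open>Within the closure of \<open>\<Omega>\<close>, a second-layer neuron has positive input exactly on its own cell.\<close>
  have gate: "rho k (pre (\<tau>, \<alpha>) x) = (if \<tau> = \<sigma> then ?g \<alpha> x ^ k else 0)"
    if "\<sigma> \<in> \<T>" "x \<in> ?cell \<sigma>" "\<tau> \<in> \<T>" "\<alpha> \<in> ?A" for \<sigma> \<tau> \<alpha> x
  proof -
    have x: "x \<in> closure \<Omega>" using that cells by blast
    show ?thesis
    proof (cases "\<tau> = \<sigma>")
      case True
      then show ?thesis using that pre_in[of "(\<tau>, \<alpha>)" x] g_bounds(1)[OF that(4) x] by (simp add: rho_if)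
    next
      case False
      then have "x \<notin> ?cell \<tau>" using disj that by (auto simp: disjoint_family_on_def)
      then show ?thesis using False that x pre_out[of "(\<tau>, \<alpha>)" x] by (simp add: rho_if)
    qed
  qed
  have realized: "\<exists>W3. \<forall>x\<in>closure \<Omega>. v x = (\<Sum>j<m. network m k ?n1 ?n2 W1 b1 W20 W21 b2 W3 x j *\<^sub>R e j)"
    if basis: "ordered_basis m e E" and v: "v \<in> pw_poly_space k \<Omega> \<T> E"
    for m e and E :: "'e set" and v
  proof -
    have "\<exists>W. \<forall>x\<in>closure \<tau>. v x = (\<Sum>j<m. (\<Sum>\<alpha>\<in>?A. W j \<alpha> * ?g \<alpha> x ^ k) *\<^sub>R e j)"
      if \<tau>: "\<tau> \<in> \<T>" for \<tau>
    proof -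
      have "closure \<tau> \<subseteq> closure \<Omega>" using cover \<tau> by blast
      then obtain p where p: "p \<in> polynomials k E" "\<forall>x\<in>closure \<tau>. v x = p x"
        using pw_poly_space_on_closure[OF v \<tau>] by blast
      obtain W where "\<forall>x. p x = (\<Sum>j<m. (\<Sum>\<alpha>\<in>?A. W j \<alpha> * ?g \<alpha> x ^ k) *\<^sub>R e j)"
        using polynomial_coordinates_in_powers[OF p(1) basis B] by blast
      then show ?thesis using p(2) by (intro exI[of _ W]) simp
    qed
    then have "\<forall>\<tau>\<in>\<T>. \<exists>W. \<forall>x\<in>closure \<tau>. v x = (\<Sum>j<m. (\<Sum>\<alpha>\<in>?A. W j \<alpha> * ?g \<alpha> x ^ k) *\<^sub>R e j)"
      by (rule ballI)
    then obtain W where "\<forall>\<tau>\<in>\<T>. \<forall>x\<in>closure \<tau>. v x = (\<Sum>j<m. (\<Sum>\<alpha>\<in>?A. W \<tau> j \<alpha> * ?g \<alpha> x ^ k) *\<^sub>R e j)"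
      unfolding bchoice_iff by (elim exE)
    note W = bspec[OF bspec[OF this]]
    obtain W3 where "\<forall>x j. network m k ?n1 ?n2 W1 b1 W20 W21 b2 W3 x j =
        (if j < m then \<Sum>q\<in>?Q. W (fst q) j (snd q) * rho k ((\<Sum>p\<in>?P. U0 q p * rho 0 (?a p \<bullet> x + ?b p)) +
          (\<Sum>p\<in>?P. U1 q p * rho 1 (?a p \<bullet> x + ?b p)) + c q) else 0)"
      using net[THEN spec, of m, THEN spec, of "\<lambda>j q. W (fst q) j (snd q)"] by (elim exE)
    then have W3: "network m k ?n1 ?n2 W1 b1 W20 W21 b2 W3 x j =
        (\<Sum>q\<in>?Q. W (fst q) j (snd q) * rho k (pre q x))" if "j < m" for x j
      using that by (simp only: U if_True cong: sum.cong)
    show ?thesis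
    proof (intro exI[of _ W3] ballI)
      fix x assume "x \<in> closure \<Omega>"
      then obtain \<sigma> where \<sigma>: "\<sigma> \<in> \<T>" "x \<in> ?cell \<sigma>" using cells by blast
      have "(\<Sum>q\<in>?Q. W (fst q) j (snd q) * rho k (pre q x)) = (\<Sum>\<alpha>\<in>?A. W \<sigma> j \<alpha> * ?g \<alpha> x ^ k)" for j
      proof -
        have "(\<Sum>q\<in>?Q. W (fst q) j (snd q) * rho k (pre q x)) =
            (\<Sum>\<tau>\<in>\<T>. \<Sum>\<alpha>\<in>?A. W \<tau> j \<alpha> * rho k (pre (\<tau>, \<alpha>) x))"
          by (simp add: sum.cartesian_product split_beta)
        also have "\<dots> = (\<Sum>\<tau>\<in>\<T>. if \<tau> = \<sigma> then \<Sum>\<alpha>\<in>?A. W \<tau> j \<alpha> * ?g \<alpha> x ^ k else 0)"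
          by (intro sum.cong refl) (simp add: gate[OF \<sigma>])
        finally show ?thesis using \<sigma>(1) fin by simp
      qed
      moreover have "x \<in> closure \<sigma>"
        using half_open_cell_subset_closure[OF _ I] simplices \<sigma> by blast
      ultimately show "v x = (\<Sum>j<m. network m k ?n1 ?n2 W1 b1 W20 W21 b2 W3 x j *\<^sub>R e j)"
        using W[OF \<sigma>(1)] W3 by simp
    qed
  qed
  have member: "network m k n1 n2 W1 b1 W20 W21 b2 W3 \<in> NN m k n1 n2" for m n1 n2 W3
    unfolding NN_def by blast
  show ?thesis
    unfolding Let_def
  proof ((rule exI)+, intro allI impI ballI)
    fix m e v and E :: "'e set"
    assume "ordered_basis m e E" and "v \<in> pw_poly_space k \<Omega> \<T> E"
    from realized[OF this] show "\<exists>W3. \<exists>f\<in>NN m k ?n1 ?n2.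
        f = network m k ?n1 ?n2 W1 b1 W20 W21 b2 W3 \<and>
        (\<forall>x\<in>closure \<Omega>. v x = (\<Sum>j<m. f x j *\<^sub>R e j))"
      by (elim exE) (rule exI, rule bexI[OF conjI[OF refl] member])
  qed
qed

end
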